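(* Consider the exponential decay change-point model. If the link function $\widetilde\Psi$ is continuous and the spectral radius satisfies $\rho(\mathbb G)<1$, then for any block $\Xi\in[K]^\ell$ and any $\epsilon>0$ there exists a positive integer $M(\Xi,\epsilon)$ such that for any $M\ge M(\Xi,\epsilon)$ $$\sup_{t\ge0,\,z\in[K]^t,\,j\in[\ell]}\Big|\frac1M\sum_{s=1}^M\omega\big(\pi_{t+s}(z,\Xi(j:s+j-1))\big)-d(\Xi)\Big|\le\epsilon,\qquad d(\Xi)=\frac1\ell\sum_{j=1}^\ell\omega\big(\widetilde\Psi(\chi_j[1])\big),$$ where $\omega(x)=|\log(1-x)|$, $\chi_j[1]$ is the first coordinate of $\chi_j$ and $$\chi_j=(\mathbb I-\mathbb G^\ell)^{-1}\sum_{i=j-\ell+1}^j\mathbb G^{j-i}\mathbb Q(\Xi(i)),\qquad1\le j\le\ell.$$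
   Context: Fix $K\ge2$, $[K]=\{1,\dots,K\}$. In the change-point model, $\pi_t(x_1,\dots,x_t)\in[0,1)$ is the conditional probability that the change occurs at time $t$, given that it has not occurred before and that treatments $x_1,\dots,x_t\in[K]$ have been assigned. Exponential decay model: $\pi_t(x_1,\dots,x_t)=\widetilde\Psi(\xi_t)$, $\xi_t=\sum_{i=1}^\kappa r_i\xi_{t-i}+q_{x_t}$, $t\ge1$, where $\kappa\ge1$, $\widetilde\Psi:\mathbb R\to[0,1)$, $r_i\in[0,1]$, $q_x\ge0$, and the initial values $\xi_0,\dots,\xi_{1-\kappa}$ are fixed. $\mathbb G$ is the $\kappa\times\kappa$ companion matrix with first row $(r_1,\dots,r_\kappa)$, ones on the subdiagonal (entries $(i+1,i)$), zeros elsewhere; $\mathbb Q(x)=(q_x,0,\dots,0)^\top\in\mathbb R^\kappa$; $\mathbb I$ is the identity; $\rho(\mathbb G)$ the spectral radius. A block $\Xi\in[K]^\ell$ is extended cyclically: $\Xi(m\ell+i)=\Xi(i)$ for every integer $m$, $1\le i\le\ell$; $\Xi(i:j)=(\Xi(i),\dots,\Xi(j))$. In $\pi_{t+s}(z,\Xi(j:s+j-1))$ the first $t$ treatments are $z$ and the next $s$ are $\Xi(j),\dots,\Xi(s+j-1)$. *)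

theory Defs
  imports
    "Jordan_Normal_Form.Spectral_Radius"
    "Jordan_Normal_Form.Gauss_Jordan_Elimination"
    "HOL-Library.Extended_Real"
begin

text \<open>
  The state \<open>\<xi>\<^sub>t\<close> for an integer time \<open>t\<close>. The values \<open>init t\<close> with \<open>1 - \<kappa> \<le> t \<le> 0\<close> are the
  initial values; the treatment at time \<open>t \<ge> 1\<close> is entry \<open>t - 1\<close> of the list \<open>xs\<close>.
\<close>

function decay_state ::
  "nat \<Rightarrow> (nat \<Rightarrow> real) \<Rightarrow> (nat \<Rightarrow> real) \<Rightarrow> (int \<Rightarrow> real) \<Rightarrow> nat list \<Rightarrow> int \<Rightarrow> real"
where
  "decay_state \<kappa> r q init xs t =
     (if t \<le> 0 then init t
      else (\<Sum>i\<in>{1..\<kappa>}. r i * decay_state \<kappa> r q init xs (t - int i)) + q (xs ! nat (t - 1)))"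
  by pat_completeness auto
termination
  by (relation "measure (\<lambda>(\<kappa>, r, q, init, xs, t). nat t)") auto

declare decay_state.simps [simp del]

definition change_prob ::
  "(real \<Rightarrow> real) \<Rightarrow> nat \<Rightarrow> (nat \<Rightarrow> real) \<Rightarrow> (nat \<Rightarrow> real) \<Rightarrow> (int \<Rightarrow> real) \<Rightarrow> nat \<Rightarrow> nat list \<Rightarrow> real"
where
  "change_prob \<Psi> \<kappa> r q init t xs = \<Psi> (decay_state \<kappa> r q init xs (int t))"

text \<open>Matrix and vector indices start at 0, whereas the coefficients are \<open>r 1, \<dots>, r \<kappa>\<close>.\<close>

definition companion :: "nat \<Rightarrow> (nat \<Rightarrow> real) \<Rightarrow> real mat" where
  "companion \<kappa> r =
     mat \<kappa> \<kappa> (\<lambda>(i, j). if i = 0 then r (j + 1) else if i = j + 1 then 1 else 0)"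

definition input_vec :: "nat \<Rightarrow> (nat \<Rightarrow> real) \<Rightarrow> nat \<Rightarrow> real vec" where
  "input_vec \<kappa> q x = vec \<kappa> (\<lambda>i. if i = 0 then q x else 0)"

definition block_at :: "nat list \<Rightarrow> int \<Rightarrow> nat" where
  "block_at \<Xi> i = \<Xi> ! nat ((i - 1) mod int (length \<Xi>))"

lemma block_at_cyclic:
  assumes "1 \<le> i" "i \<le> length \<Xi>"
  shows "block_at \<Xi> (m * int (length \<Xi>) + int i) = \<Xi> ! (i - 1)"
proof -
  have "(m * int (length \<Xi>) + int i - 1) mod int (length \<Xi>) = (int i - 1) mod int (length \<Xi>)"
    by (metis add_diff_eq add.commute mod_mult_self1)
  also have "\<dots> = int i - 1"
    using assms by (intro mod_pos_pos_trivial) auto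
  finally show ?thesis
    using assms by (simp add: block_at_def nat_diff_distrib)
qed

definition block_segment :: "nat list \<Rightarrow> int \<Rightarrow> int \<Rightarrow> nat list" where
  "block_segment \<Xi> i j = map (block_at \<Xi>) [i..j]"

definition limit_state ::
  "nat \<Rightarrow> (nat \<Rightarrow> real) \<Rightarrow> (nat \<Rightarrow> real) \<Rightarrow> nat list \<Rightarrow> int \<Rightarrow> real vec"
where
  "limit_state \<kappa> r q \<Xi> j =
     the (mat_inverse (1\<^sub>m \<kappa> - companion \<kappa> r ^\<^sub>m length \<Xi>)) *\<^sub>v
       finsum_vec TYPE(real) \<kappa>
         (\<lambda>i. companion \<kappa> r ^\<^sub>m nat (j - i) *\<^sub>v input_vec \<kappa> q (block_at \<Xi> i))
         {j - int (length \<Xi>) + 1..j}"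

definition omega :: "real \<Rightarrow> real" where
  "omega x = \<bar>ln (1 - x)\<bar>"

definition block_mean ::
  "(real \<Rightarrow> real) \<Rightarrow> nat \<Rightarrow> (nat \<Rightarrow> real) \<Rightarrow> (nat \<Rightarrow> real) \<Rightarrow> nat list \<Rightarrow> real"
where
  "block_mean \<Psi> \<kappa> r q \<Xi> =
     (1 / real (length \<Xi>)) *
       (\<Sum>j\<in>{1..int (length \<Xi>)}. omega (\<Psi> (limit_state \<kappa> r q \<Xi> j $ 0)))"

end

theory Submission
  imports Defs "HOL-Analysis.Elementary_Metric_Spaces"
begin

text \<open>
  For nonnegative coefficients, spectral radius below 1 forces \<open>S = r 1 + \<dots> + r \<kappa> < 1\<close>, so every
  solution of the homogeneous recurrence shrinks by the factor \<open>S\<close> over each window of \<open>\<kappa>\<close> steps.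
  This makes \<open>1 - G\<^sup>l\<close> injective, and the first coordinates of the limit states then form an
  \<open>l\<close>-periodic solution of the recurrence driven by the cyclic block. The difference between the
  decay state and this periodic solution is homogeneous, hence tends to 0 at a rate depending only
  on the uniform bound for the states. Uniform continuity of \<open>\<omega> \<circ> \<Psi>\<close> on the compact range of the
  states transfers this to the summands, and the mean of a periodic sequence over \<open>M\<close> terms differs
  from its mean over a period by \<open>O(1 / M)\<close>.
\<close>

section \<open>The companion matrix\<close>

lemma companion_carrier [simp]: "companion \<kappa> r \<in> carrier_mat \<kappa> \<kappa>"
  by (simp add: companion_def)

lemma companion_dim [simp]: "dim_row (companion \<kappa> r) = \<kappa>" "dim_col (companion \<kappa> r) = \<kappa>"
  by (simp_all add: companion_def)

lemma companion_mult_vec_0: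
  assumes "v \<in> carrier_vec \<kappa>" "0 < \<kappa>"
  shows "(companion \<kappa> r *\<^sub>v v) $ 0 = (\<Sum>i\<in>{1..\<kappa>}. r i * v $ (i - 1))"
proof -
  have "(companion \<kappa> r *\<^sub>v v) $ 0 = (\<Sum>i\<in>{0..<\<kappa>}. r (Suc i) * v $ i)"
    using assms by (auto simp: scalar_prod_def companion_def intro!: sum.cong)
  also have "\<dots> = (\<Sum>i\<in>{1..\<kappa>}. r i * v $ (i - 1))"
    by (rule sum.reindex_bij_witness[of _ "\<lambda>i. i - 1" Suc]) auto
  finally show ?thesis .
qed

lemma companion_mult_vec_Suc:
  assumes "v \<in> carrier_vec \<kappa>" "Suc i < \<kappa>"
  shows "(companion \<kappa> r *\<^sub>v v) $ Suc i = v $ i"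
  using assms by (simp add: scalar_prod_def companion_def if_distrib[of "\<lambda>x. x * _"] cong: if_cong)

text \<open>The hypothesis is the characteristic equation of the companion matrix. An eigenvector is
  the geometric vector (x^(\<kappa>-1), ..., x, 1): its last entry is 1 for every x, so it is
  nonzero even at x = 0, and only the first row uses the equation.\<close>

lemma companion_eigenvalue:
  fixes x :: real
  assumes "0 < \<kappa>" "(\<Sum>i\<in>{1..\<kappa>}. r i * x ^ (\<kappa> - i)) = x ^ \<kappa>"
  shows "eigenvalue (map_mat complex_of_real (companion \<kappa> r)) (complex_of_real x)"
proof -
  define v where "v = vec \<kappa> (\<lambda>i. x ^ (\<kappa> - 1 - i))"
  have v: "v \<in> carrier_vec \<kappa>"
    by (simp add: v_def)
  have "v $ (\<kappa> - 1) = 1"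
    using assms(1) by (simp add: v_def)
  then have nz: "map_vec complex_of_real v \<noteq> 0\<^sub>v \<kappa>"
    using assms(1) v by (metis carrier_vecD diff_less index_map_vec(1) index_zero_vec(1)
        less_one of_real_eq_0_iff zero_neq_one)
  have "companion \<kappa> r *\<^sub>v v = x \<cdot>\<^sub>v v"
  proof (rule eq_vecI)
    fix i assume "i < dim_vec (x \<cdot>\<^sub>v v)"
    then have i: "i < \<kappa>" by (simp add: v_def)
    show "(companion \<kappa> r *\<^sub>v v) $ i = (x \<cdot>\<^sub>v v) $ i"
    proof (cases i)
      case 0
      have "(\<Sum>i\<in>{1..\<kappa>}. r i * v $ (i - 1)) = (\<Sum>i\<in>{1..\<kappa>}. r i * x ^ (\<kappa> - i))"
        by (rule sum.cong) (auto simp: v_def)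
      also have "\<dots> = x * x ^ (\<kappa> - 1)"
        using assms by (metis power_eq_if less_numeral_extra(3))
      finally show ?thesis
        using 0 assms(1) companion_mult_vec_0[OF v assms(1), of r] by (simp add: v_def)
    next
      case (Suc k)
      have "x ^ (\<kappa> - Suc k) = x * x ^ (\<kappa> - Suc (Suc k))"
        using i Suc by (metis Suc_diff_Suc power_Suc)
      then show ?thesis
        using Suc i companion_mult_vec_Suc[OF v, of k r] by (simp add: v_def)
    qed
  qed (simp add: v_def)
  then have "map_mat complex_of_real (companion \<kappa> r) *\<^sub>v map_vec complex_of_real v
      = complex_of_real x \<cdot>\<^sub>v map_vec complex_of_real v"
    by (metis companion_carrier of_real_hom.mult_mat_vec_hom of_real_hom.vec_hom_smult v)
  then show ?thesis
    unfolding eigenvalue_def eigenvector_def using nz v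
    by (intro exI[of _ "map_vec complex_of_real v"]) auto
qed

text \<open>
  If the coefficients sum to \<open>S \<ge> 1\<close>, then \<open>\<Sum>i. r i * x ^ (\<kappa> - i) - x ^ \<kappa>\<close> is nonnegative
  at \<open>1\<close> and nonpositive at \<open>S\<close>, which produces a real eigenvalue of modulus at least 1.
\<close>

lemma coefficient_sum_less_1:
  assumes "0 < \<kappa>" and r: "\<And>i. i \<in> {1..\<kappa>} \<Longrightarrow> 0 \<le> r i"
    and sr: "spectral_radius (map_mat complex_of_real (companion \<kappa> r)) < 1"
  shows "(\<Sum>i\<in>{1..\<kappa>}. r i) < 1"
proof (rule ccontr)
  define S where "S = (\<Sum>i\<in>{1..\<kappa>}. r i)"
  assume "\<not> (\<Sum>i\<in>{1..\<kappa>}. r i) < 1"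
  then have S: "1 \<le> S" by (simp add: S_def)
  define f where "f = (\<lambda>x::real. (\<Sum>i\<in>{1..\<kappa>}. r i * x ^ (\<kappa> - i)) - x ^ \<kappa>)"
  have "f 1 \<ge> 0"
    using S by (simp add: f_def S_def)
  moreover have "f S \<le> 0"
  proof -
    \<comment> \<open>Since S is at least 1 and i is at least 1, raising each exponent \<kappa> - i
      to \<kappa> - 1 only increases the sum; the coefficients then contribute one more factor
      S.\<close>
    have "(\<Sum>i\<in>{1..\<kappa>}. r i * S ^ (\<kappa> - i)) \<le> (\<Sum>i\<in>{1..\<kappa>}. r i * S ^ (\<kappa> - 1))"
      using S r by (intro sum_mono mult_left_mono power_increasing) auto
    also have "\<dots> = S * S ^ (\<kappa> - 1)"
      by (simp add: S_def sum_distrib_right)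
    also have "\<dots> = S ^ \<kappa>"
      using assms(1) by (metis power_eq_if less_numeral_extra(3))
    finally show ?thesis by (simp add: f_def)
  qed
  moreover have "continuous_on {1..S} f"
    unfolding f_def by (intro continuous_intros)
  ultimately obtain x where x: "1 \<le> x" "f x = 0"
    using IVT2'[of f S 0 1] S by auto
  then have "eigenvalue (map_mat complex_of_real (companion \<kappa> r)) (complex_of_real x)"
    using assms(1) by (intro companion_eigenvalue) (auto simp: f_def)
  then have "norm (complex_of_real x) \<in> norm ` spectrum (map_mat complex_of_real (companion \<kappa> r))"
    unfolding spectrum_def by blast
  then have "norm (complex_of_real x) \<le> spectral_radius (map_mat complex_of_real (companion \<kappa> r))"
    using assms(1) by (intro spectral_radius_mem_max(2)[of _ \<kappa>]) auto
  then show False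
    using x sr by simp
qed

section \<open>Powers of matrices acting on vectors\<close>

text \<open>\<open>pow_mat\<close> appends its new factor on the right. Bringing a factor in from
  the left takes an induction with \<open>v\<close> arbitrary, because the hypothesis is applied to
  the image of \<open>v\<close> under \<open>A\<close>.\<close>

lemma mult_mat_vec_pow:
  fixes A :: "'a :: comm_semiring_1 mat"
  assumes "A \<in> carrier_mat n n" "v \<in> carrier_vec n"
  shows "A *\<^sub>v (A ^\<^sub>m k *\<^sub>v v) = A ^\<^sub>m Suc k *\<^sub>v v"
  using assms(2)
proof (induction k arbitrary: v)
  case 0
  then show ?case using assms(1) by simp
next
  case (Suc k)
  have "A *\<^sub>v (A ^\<^sub>m Suc k *\<^sub>v v) = A *\<^sub>v (A ^\<^sub>m k *\<^sub>v (A *\<^sub>v v))"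
    using assms(1) Suc.prems by (simp add: assoc_mult_mat_vec[of _ n n _ n])
  also have "\<dots> = A ^\<^sub>m Suc k *\<^sub>v (A *\<^sub>v v)"
    using assms(1) Suc.prems by (intro Suc.IH) auto
  also have "\<dots> = A ^\<^sub>m Suc (Suc k) *\<^sub>v v"
    using assoc_mult_mat_vec[OF pow_carrier_mat[OF assms(1)] assms(1) Suc.prems, of "Suc k"]
    by (simp only: pow_mat.simps)
  finally show ?case .
qed

lemma mult_mat_vec_pow_commute:
  fixes A :: "'a :: comm_semiring_1 mat"
  assumes "A \<in> carrier_mat n n" "v \<in> carrier_vec n"
  shows "A ^\<^sub>m k *\<^sub>v (A *\<^sub>v v) = A *\<^sub>v (A ^\<^sub>m k *\<^sub>v v)"
  using assms by (simp add: mult_mat_vec_pow assoc_mult_mat_vec[of "A ^\<^sub>m k" n n A n v])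

lemma mult_mat_vec_finsum_vec:
  fixes A :: "'a :: comm_semiring_1 mat"
  assumes "A \<in> carrier_mat m n" "finite F" "f \<in> F \<rightarrow> carrier_vec n"
  shows "A *\<^sub>v finsum_vec TYPE('a) n f F = finsum_vec TYPE('a) m (\<lambda>i. A *\<^sub>v f i) F"
  using assms(2,3)
proof (induction F rule: finite_induct)
  case empty
  then show ?case using assms(1) by (auto simp: finsum_vec_empty)
next
  case (insert x F)
  have *: "(\<lambda>i. A *\<^sub>v f i) \<in> F \<rightarrow> carrier_vec m" "A *\<^sub>v f x \<in> carrier_vec m"
    using insert.prems assms(1) by (auto intro!: mult_mat_vec_carrier)
  show ?case
    using insert assms(1) *
    by (simp add: finsum_vec_insert mult_add_distrib_mat_vec[of _ m n] finsum_vec_closed)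
qed

text \<open>A trivial kernel makes the determinant nonzero, so the option returned by
  \<open>mat_inverse\<close> is not \<open>None\<close> and \<open>the\<close> yields a genuine
  two-sided inverse.\<close>

lemma mat_inverse_mult_vec:
  fixes A :: "'a :: field mat"
  assumes A: "A \<in> carrier_mat n n"
    and ker: "\<And>v. v \<in> carrier_vec n \<Longrightarrow> A *\<^sub>v v = 0\<^sub>v n \<Longrightarrow> v = 0\<^sub>v n"
    and v: "v \<in> carrier_vec n"
  shows "the (mat_inverse A) \<in> carrier_mat n n" "the (mat_inverse A) *\<^sub>v (A *\<^sub>v v) = v"
    "A *\<^sub>v (the (mat_inverse A) *\<^sub>v v) = v"
proof -
  have "det A \<noteq> 0"
    using det_0_iff_vec_prod_zero_field[OF A] ker by auto
  \<comment> \<open>The unit value fixes the arbitrary last parameter of \<open>ring_mat\<close>, so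
    that both facts speak of the same matrix ring.\<close>
  then have "mat_inverse A \<noteq> None"
    using mat_inverse(1)[OF A, of "()"] det_non_zero_imp_unit[OF A, of "()"] by blast
  then obtain B where B: "mat_inverse A = Some B" by auto
  note * = mat_inverse(2)[OF A B]
  show "the (mat_inverse A) \<in> carrier_mat n n" using B * by simp
  show "the (mat_inverse A) *\<^sub>v (A *\<^sub>v v) = v" "A *\<^sub>v (the (mat_inverse A) *\<^sub>v v) = v"
    using B * A v by (auto simp flip: assoc_mult_mat_vec[of _ n n _ n])
qed

section \<open>Stable linear recurrences\<close>

text \<open>The recurrence weights sum to S, so a bound valid on the previous \<kappa> terms
  improves by the factor S. The exponent \<open>n div \<kappa>\<close> counts the complete windows
  passed.\<close>

lemma stable_recurrence_decay:
  fixes u r :: "nat \<Rightarrow> real"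
  assumes \<kappa>: "0 < \<kappa>" and r: "\<And>i. i \<in> {1..\<kappa>} \<Longrightarrow> 0 \<le> r i"
    and S1: "(\<Sum>i\<in>{1..\<kappa>}. r i) \<le> 1"
    and init: "\<And>n. n < \<kappa> \<Longrightarrow> \<bar>u n\<bar> \<le> B"
    and rec: "\<And>n. \<kappa> \<le> n \<Longrightarrow> u n = (\<Sum>i\<in>{1..\<kappa>}. r i * u (n - i))"
  shows "\<bar>u n\<bar> \<le> B * (\<Sum>i\<in>{1..\<kappa>}. r i) ^ (n div \<kappa>)"
proof (induction n rule: less_induct)
  case (less n)
  define S where "S = (\<Sum>i\<in>{1..\<kappa>}. r i)"
  have S: "0 \<le> S" "S \<le> 1"
    using r S1 by (auto simp: S_def intro: sum_nonneg)
  have B: "0 \<le> B" using init[OF \<kappa>] by linarith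
  show ?case
  proof (cases "n < \<kappa>")
    case True
    then show ?thesis using init by simp
  next
    case False
    have "\<bar>u n\<bar> \<le> (\<Sum>i\<in>{1..\<kappa>}. \<bar>r i * u (n - i)\<bar>)"
      using rec[of n] False by simp
    also have "\<dots> \<le> (\<Sum>i\<in>{1..\<kappa>}. r i * (B * S ^ (n div \<kappa> - 1)))"
    proof (rule sum_mono)
      fix i assume i: "i \<in> {1..\<kappa>}"
      \<comment> \<open>The index n - i lies at most one window behind n, so its exponent drops by
        at most 1; powers of S decrease because S is at most 1.\<close>
      have "n div \<kappa> - 1 = (n - \<kappa>) div \<kappa>"
        using False \<kappa> by (simp add: le_div_geq)
      also have "\<dots> \<le> (n - i) div \<kappa>"
        using i by (intro div_le_mono) auto
      finally have "S ^ ((n - i) div \<kappa>) \<le> S ^ (n div \<kappa> - 1)"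
        using S by (intro power_decreasing) auto
      moreover have "\<bar>u (n - i)\<bar> \<le> B * S ^ ((n - i) div \<kappa>)"
        using less.IH[of "n - i"] i False by (simp add: S_def)
      ultimately have "\<bar>u (n - i)\<bar> \<le> B * S ^ (n div \<kappa> - 1)"
        using B by (meson mult_left_mono order_trans)
      then show "\<bar>r i * u (n - i)\<bar> \<le> r i * (B * S ^ (n div \<kappa> - 1))"
        using r[OF i] by (simp add: abs_mult mult_left_mono)
    qed
    also have "\<dots> = B * (S * S ^ (n div \<kappa> - 1))"
      unfolding sum_distrib_right[symmetric] S_def[symmetric] by simp
    also have "S * S ^ (n div \<kappa> - 1) = S ^ (n div \<kappa>)"
      using False \<kappa> by (metis div_greater_zero_iff leI power_eq_if less_numeral_extra(3))
    finally show ?thesis by (simp add: S_def)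
  qed
qed

text \<open>The orbit of \<open>v\<close> under the companion matrix is l-periodic, while its first
  coordinate solves the homogeneous recurrence and decays. A periodic sequence tending to 0
  vanishes. This is the injectivity behind the inverse in \<open>limit_state\<close>, obtained
  without studying the spectrum of powers.\<close>

lemma companion_pow_fixed_vec:
  assumes \<kappa>: "0 < \<kappa>" and r: "\<And>i. i \<in> {1..\<kappa>} \<Longrightarrow> 0 \<le> r i"
    and S1: "(\<Sum>i\<in>{1..\<kappa>}. r i) < 1"
    and v: "v \<in> carrier_vec \<kappa>" and l: "0 < l"
    and fix_v: "companion \<kappa> r ^\<^sub>m l *\<^sub>v v = v"
  shows "v = 0\<^sub>v \<kappa>"
proof -
  define G where "G = companion \<kappa> r"
  define w where "w n = G ^\<^sub>m n *\<^sub>v v" for n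
  define S where "S = (\<Sum>i\<in>{1..\<kappa>}. r i)"
  have G: "G \<in> carrier_mat \<kappa> \<kappa>" by (simp add: G_def)
  have w: "w n \<in> carrier_vec \<kappa>" for n
    using mult_mat_vec_carrier[OF pow_carrier_mat[OF G] v] by (simp add: w_def)
  have w_Suc: "w (Suc n) = G *\<^sub>v w n" for n
    using mult_mat_vec_pow[OF G v] by (simp add: w_def)
  have per: "w (n + l) = w n" for n
    by (induction n) (use fix_v v G in \<open>simp_all add: w_Suc, simp_all add: w_def G_def\<close>)
  have per': "w (n + k * l) = w n" for n k
    by (induction k) (simp, metis per add.assoc add.commute mult_Suc)
  \<comment> \<open>The ones on the subdiagonal push each coordinate one place down per step, so
    coordinate i remembers the first coordinate from i steps before.\<close>
  have shift: "w (n + i) $ i = w n $ 0" if "i < \<kappa>" for n i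
    using that
  proof (induction i)
    case (Suc i)
    then show ?case
      using companion_mult_vec_Suc[OF w, of i] by (simp add: w_Suc G_def)
  qed simp
  define B where "B = (\<Sum>n<\<kappa>. \<bar>w n $ 0\<bar>)"
  have bound: "\<bar>w n $ 0\<bar> \<le> B * S ^ (n div \<kappa>)" for n
    unfolding S_def
  proof (rule stable_recurrence_decay)
    fix n assume "n < \<kappa>"
    then show "\<bar>w n $ 0\<bar> \<le> B"
      unfolding B_def by (intro member_le_sum[of n "{..<\<kappa>}" "\<lambda>n. \<bar>w n $ 0\<bar>"]) auto
  next
    fix n assume n: "\<kappa> \<le> n"
    then have "w n $ 0 = (G *\<^sub>v w (n - 1)) $ 0"
      using \<kappa> by (cases n) (auto simp: w_Suc)
    also have "\<dots> = (\<Sum>i\<in>{1..\<kappa>}. r i * w (n - 1) $ (i - 1))"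
      unfolding G_def using \<kappa> by (rule companion_mult_vec_0[OF w])
    also have "\<dots> = (\<Sum>i\<in>{1..\<kappa>}. r i * w (n - i) $ 0)"
    proof (rule sum.cong)
      fix i assume "i \<in> {1..\<kappa>}"
      then show "r i * w (n - 1) $ (i - 1) = r i * w (n - i) $ 0"
        using shift[of "i - 1" "n - i"] n by (cases i) auto
    qed simp
    finally show "w n $ 0 = (\<Sum>i\<in>{1..\<kappa>}. r i * w (n - i) $ 0)" .
  qed (use \<kappa> r S1 in auto)
  have S: "0 \<le> S" "S < 1"
    using r S1 by (auto simp: S_def intro: sum_nonneg)
  have zero: "w n $ 0 = 0" for n
  proof -
    have "\<bar>w n $ 0\<bar> \<le> B * S ^ m" for m
    proof -
      \<comment> \<open>Advancing n by m * \<kappa> whole periods keeps the value of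
        \<open>w\<close> and, as l is at least 1, passes at least m windows.\<close>
      have "m * \<kappa> \<le> n + (m * \<kappa>) * l"
        using l by (simp add: trans_le_add2)
      then have "m \<le> (n + (m * \<kappa>) * l) div \<kappa>"
        using \<kappa> by (simp add: less_eq_div_iff_mult_less_eq)
      then have "S ^ ((n + (m * \<kappa>) * l) div \<kappa>) \<le> S ^ m"
        using S by (intro power_decreasing) auto
      moreover have "0 \<le> B" by (simp add: B_def sum_nonneg)
      moreover have "\<bar>w n $ 0\<bar> \<le> B * S ^ ((n + (m * \<kappa>) * l) div \<kappa>)"
        using bound[of "n + (m * \<kappa>) * l"] by (simp add: per')
      ultimately show ?thesis by (meson mult_left_mono order_trans)
    qed
    moreover have "(\<lambda>m. B * S ^ m) \<longlonglongrightarrow> B * 0"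
      using S by (intro tendsto_intros LIMSEQ_realpow_zero)
    ultimately have "\<bar>w n $ 0\<bar> \<le> B * 0"
      by (intro LIMSEQ_le_const) auto
    then show ?thesis by simp
  qed
  show ?thesis
  proof (rule eq_vecI)
    fix i assume "i < dim_vec (0\<^sub>v \<kappa>)"
    then have i: "i < \<kappa>" by simp
    \<comment> \<open>The vector \<open>v\<close> recurs at time i * l, which is late enough to
      trace coordinate i back to a first coordinate.\<close>
    have "i \<le> i * l" using l by simp
    then have "w (i * l) $ i = 0"
      using shift[OF i, of "i * l - i"] zero by simp
    moreover have "w (i * l) = v"
      using per'[of 0 i] v G by (simp add: w_def)
    ultimately show "v $ i = 0\<^sub>v \<kappa> $ i" using i by simp
  qed (use v in auto)
qed

section \<open>The periodic limit\<close>

lemma block_at_add_length: "block_at \<Xi> (i + int (length \<Xi>)) = block_at \<Xi> i"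
proof -
  have "i + int (length \<Xi>) - 1 = (i - 1) + int (length \<Xi>)" by simp
  then show ?thesis
    unfolding block_at_def by (metis mod_add_self2)
qed

lemma block_at_in_set: "\<Xi> \<noteq> [] \<Longrightarrow> block_at \<Xi> i \<in> set \<Xi>"
  unfolding block_at_def by (intro nth_mem) (simp add: nat_less_iff)

lemma input_vec_carrier [simp]: "input_vec \<kappa> q x \<in> carrier_vec \<kappa>"
  by (simp add: input_vec_def)

text \<open>Translating the summation index by one block length preserves both the exponents j - i
  and the cyclic block entries.\<close>

lemma limit_state_add_length:
  "limit_state \<kappa> r q \<Xi> (j + int (length \<Xi>)) = limit_state \<kappa> r q \<Xi> j"
proof -
  define f where "f j i = companion \<kappa> r ^\<^sub>m nat (j - i) *\<^sub>v input_vec \<kappa> q (block_at \<Xi> i)" for j i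
  have f: "f j i \<in> carrier_vec \<kappa>" for j i
    unfolding f_def by (intro mult_mat_vec_carrier[of _ \<kappa> \<kappa>]) auto
  let ?l = "int (length \<Xi>)"
  have "finsum_vec TYPE(real) \<kappa> (f (j + ?l)) {j + ?l - ?l + 1..j + ?l}
      = finsum_vec TYPE(real) \<kappa> (f j) {j - ?l + 1..j}"
  proof (rule eq_vecI)
    fix k assume "k < dim_vec (finsum_vec TYPE(real) \<kappa> (f j) {j - ?l + 1..j})"
    moreover have "finsum_vec TYPE(real) \<kappa> (f j) {j - ?l + 1..j} \<in> carrier_vec \<kappa>"
      using f by (intro finsum_vec_closed) auto
    ultimately have k: "k < \<kappa>" by auto
    have "(\<Sum>i\<in>{j + ?l - ?l + 1..j + ?l}. f (j + ?l) i $ k) = (\<Sum>i\<in>{j - ?l + 1..j}. f j i $ k)"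
    proof (rule sum.reindex_bij_witness[of _ "\<lambda>i. i + ?l" "\<lambda>i. i - ?l"])
      fix i
      show "f j (i - ?l) $ k = f (j + ?l) i $ k"
        using block_at_add_length[of \<Xi> "i - ?l"] by (simp add: f_def algebra_simps)
    qed auto
    then show "finsum_vec TYPE(real) \<kappa> (f (j + ?l)) {j + ?l - ?l + 1..j + ?l} $ k
        = finsum_vec TYPE(real) \<kappa> (f j) {j - ?l + 1..j} $ k"
      using f k by (simp add: index_finsum_vec)
  next
    have "finsum_vec TYPE(real) \<kappa> (f i) F \<in> carrier_vec \<kappa>" for i F
      using f by (intro finsum_vec_closed) auto
    then show "dim_vec (finsum_vec TYPE(real) \<kappa> (f (j + ?l)) {j + ?l - ?l + 1..j + ?l})
        = dim_vec (finsum_vec TYPE(real) \<kappa> (f j) {j - ?l + 1..j})"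
      by (metis carrier_vecD)
  qed
  then show ?thesis
    by (simp add: limit_state_def f_def[abs_def])
qed

text \<open>
  With \<open>b\<^sub>j\<close> the sum in the definition of \<open>limit_state\<close>, cyclicity of the block gives
  \<open>G b\<^bsub>j-1\<^esub> + Q\<^sub>j = b\<^sub>j + G\<^sup>l Q\<^sub>j\<close>; dividing by \<open>1 - G\<^sup>l\<close>, which commutes with \<open>G\<close>, shows that the
  limit states solve the recurrence.
\<close>

lemma limit_state_step:
  assumes \<kappa>: "0 < \<kappa>" and r: "\<And>i. i \<in> {1..\<kappa>} \<Longrightarrow> 0 \<le> r i"
    and S1: "(\<Sum>i\<in>{1..\<kappa>}. r i) < 1" and ne: "\<Xi> \<noteq> []"
  shows "limit_state \<kappa> r q \<Xi> j \<in> carrier_vec \<kappa>"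
    and "limit_state \<kappa> r q \<Xi> j
      = companion \<kappa> r *\<^sub>v limit_state \<kappa> r q \<Xi> (j - 1) + input_vec \<kappa> q (block_at \<Xi> j)"
proof -
  define l where "l = length \<Xi>"
  have l: "0 < l" using ne by (simp add: l_def)
  define G where "G = companion \<kappa> r"
  have G [simp]: "G \<in> carrier_mat \<kappa> \<kappa>" by (simp add: G_def)
  have pow [simp]: "G ^\<^sub>m k \<in> carrier_mat \<kappa> \<kappa>" for k by simp
  define A where "A = 1\<^sub>m \<kappa> - G ^\<^sub>m l"
  have A: "A \<in> carrier_mat \<kappa> \<kappa>" unfolding A_def by (intro minus_carrier_mat pow)
  define Q where "Q i = input_vec \<kappa> q (block_at \<Xi> i)" for i
  have Q [simp]: "Q i \<in> carrier_vec \<kappa>" for i by (simp add: Q_def)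
  define f where "f j i = G ^\<^sub>m nat (j - i) *\<^sub>v Q i" for j i
  have f [simp]: "f j i \<in> carrier_vec \<kappa>" for j i
    unfolding f_def by (rule mult_mat_vec_carrier[OF pow Q])
  define b where "b j = finsum_vec TYPE(real) \<kappa> (f j) {j - int l + 1..j}" for j
  have b [simp]: "b j \<in> carrier_vec \<kappa>" for j
    unfolding b_def by (intro finsum_vec_closed) auto
  have A_mult: "A *\<^sub>v v = v - G ^\<^sub>m l *\<^sub>v v" if "v \<in> carrier_vec \<kappa>" for v
    unfolding A_def using minus_mult_distrib_mat_vec[OF one_carrier_mat pow that] that by simp
  have ker: "v = 0\<^sub>v \<kappa>" if v: "v \<in> carrier_vec \<kappa>" and 0: "A *\<^sub>v v = 0\<^sub>v \<kappa>" for v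
  proof (rule companion_pow_fixed_vec[OF \<kappa> r S1 v l])
    have w: "G ^\<^sub>m l *\<^sub>v v \<in> carrier_vec \<kappa>"
      using pow v by (rule mult_mat_vec_carrier)
    have "(G ^\<^sub>m l *\<^sub>v v) $ i = v $ i" if "i < \<kappa>" for i
    proof -
      have "(v - G ^\<^sub>m l *\<^sub>v v) $ i = 0"
        using 0 A_mult[OF v] that by simp
      moreover have "(v - G ^\<^sub>m l *\<^sub>v v) $ i = v $ i - (G ^\<^sub>m l *\<^sub>v v) $ i"
        using that w by (intro index_minus_vec(1)) (simp only: carrier_vecD)
      ultimately show ?thesis by simp
    qed
    then show "companion \<kappa> r ^\<^sub>m l *\<^sub>v v = v"
      unfolding G_def[symmetric] using v w by (intro eq_vecI) (simp_all only: carrier_vecD)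
  qed
  have inv: "the (mat_inverse A) \<in> carrier_mat \<kappa> \<kappa>"
    "the (mat_inverse A) *\<^sub>v (A *\<^sub>v v) = v" "A *\<^sub>v (the (mat_inverse A) *\<^sub>v v) = v"
    if "v \<in> carrier_vec \<kappa>" for v
    using mat_inverse_mult_vec[OF A _ that] ker by blast+
  define c where "c j = limit_state \<kappa> r q \<Xi> j" for j
  have c_eq: "c j = the (mat_inverse A) *\<^sub>v b j" for j
    by (simp add: c_def limit_state_def A_def b_def f_def[abs_def] Q_def G_def l_def)
  have c: "c j \<in> carrier_vec \<kappa>" for j
    unfolding c_eq using inv(1)[OF b] b by (rule mult_mat_vec_carrier)
  then show "limit_state \<kappa> r q \<Xi> j \<in> carrier_vec \<kappa>" by (simp add: c_def)
  have Ac: "A *\<^sub>v c j = b j" for j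
    unfolding c_eq using inv(3)[OF b] .
  have GQ: "G ^\<^sub>m l *\<^sub>v Q j \<in> carrier_vec \<kappa>" using pow Q by (rule mult_mat_vec_carrier)
  have Gc: "G *\<^sub>v c (j - 1) \<in> carrier_vec \<kappa>" using G c by (rule mult_mat_vec_carrier)
  have Gb: "G *\<^sub>v b (j - 1) \<in> carrier_vec \<kappa>" using G b by (rule mult_mat_vec_carrier)
  have tele: "Q j + G *\<^sub>v b (j - 1) = G ^\<^sub>m l *\<^sub>v Q j + b j"
  proof -
    \<comment> \<open>Multiplication by \<open>G\<close> raises every exponent by one, turning the
      summands for j - 1 into those for j over a window ending one index earlier.\<close>
    have "G *\<^sub>v b (j - 1) = finsum_vec TYPE(real) \<kappa> (\<lambda>i. G *\<^sub>v f (j - 1) i) {j - int l..j - 1}"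
      unfolding b_def by (subst mult_mat_vec_finsum_vec[of _ \<kappa>]) (auto simp: algebra_simps)
    also have "\<dots> = finsum_vec TYPE(real) \<kappa> (f j) {j - int l..j - 1}"
      unfolding finsum_vec_def
    proof (rule comm_monoid.finprod_cong'[OF comm_monoid_vec])
      fix i assume "i \<in> {j - int l..j - 1}"
      then have "Suc (nat (j - 1 - i)) = nat (j - i)" by auto
      then show "G *\<^sub>v f (j - 1) i = f j i"
        unfolding f_def using mult_mat_vec_pow[OF G Q] by metis
    qed (auto simp: monoid_vec_simps)
    finally have "Q j + G *\<^sub>v b (j - 1) = f j j + finsum_vec TYPE(real) \<kappa> (f j) {j - int l..j - 1}"
      using Q by (simp add: f_def carrier_matD(1)[OF G])
    also have "\<dots> = finsum_vec TYPE(real) \<kappa> (f j) (insert j {j - int l..j - 1})"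
      by (rule finsum_vec_insert[symmetric]) auto
    \<comment> \<open>The window from j - l to j is split off at either end: the term at j is the
      new input, and the term at j - l carries the same treatment multiplied by the l-th power of
      \<open>G\<close>.\<close>
    also have "insert j {j - int l..j - 1} = insert (j - int l) {j - int l + 1..j}"
      using l by auto
    also have "finsum_vec TYPE(real) \<kappa> (f j) \<dots> = f j (j - int l) + b j"
      unfolding b_def by (rule finsum_vec_insert) auto
    also have "f j (j - int l) = G ^\<^sub>m l *\<^sub>v Q j"
      using block_at_add_length[of \<Xi> "j - int l"] by (simp add: f_def Q_def l_def)
    finally show ?thesis .
  qed
  \<comment> \<open>\<open>A\<close> is a polynomial in \<open>G\<close>, hence commutes with
    it.\<close>
  have "A *\<^sub>v (G *\<^sub>v c (j - 1)) = G *\<^sub>v (A *\<^sub>v c (j - 1))"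
    using c Gc mult_minus_distrib_mat_vec[OF G c mult_mat_vec_carrier[OF pow c], of "j - 1" l "j - 1"]
    by (simp only: A_mult mult_mat_vec_pow_commute[OF G c])
  then have "A *\<^sub>v (G *\<^sub>v c (j - 1) + Q j) = G *\<^sub>v b (j - 1) + (Q j - G ^\<^sub>m l *\<^sub>v Q j)"
    using mult_add_distrib_mat_vec[OF A Gc Q] A_mult[OF Q] by (simp only: Ac)
  also have "\<dots> = b j"
  proof (rule eq_vecI)
    fix k assume "k < dim_vec (b j)"
    then have k: "k < \<kappa>" by (simp only: carrier_vecD[OF b])
    note dims = carrier_vecD[OF GQ] carrier_vecD[OF Gb] carrier_vecD[OF Q] carrier_vecD[OF b]
    have "(Q j + G *\<^sub>v b (j - 1)) $ k = (G ^\<^sub>m l *\<^sub>v Q j + b j) $ k"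
      by (simp only: tele)
    moreover have "(Q j + G *\<^sub>v b (j - 1)) $ k = Q j $ k + (G *\<^sub>v b (j - 1)) $ k"
      using k by (intro index_add_vec(1)) (simp only: dims)
    moreover have "(G ^\<^sub>m l *\<^sub>v Q j + b j) $ k = (G ^\<^sub>m l *\<^sub>v Q j) $ k + b j $ k"
      using k by (intro index_add_vec(1)) (simp only: dims)
    moreover have "(G *\<^sub>v b (j - 1) + (Q j - G ^\<^sub>m l *\<^sub>v Q j)) $ k
        = (G *\<^sub>v b (j - 1)) $ k + (Q j - G ^\<^sub>m l *\<^sub>v Q j) $ k"
      using k by (intro index_add_vec(1)) (simp only: dims index_minus_vec(2))
    moreover have "(Q j - G ^\<^sub>m l *\<^sub>v Q j) $ k = Q j $ k - (G ^\<^sub>m l *\<^sub>v Q j) $ k"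
      using k by (intro index_minus_vec(1)) (simp only: dims)
    ultimately show "(G *\<^sub>v b (j - 1) + (Q j - G ^\<^sub>m l *\<^sub>v Q j)) $ k = b j $ k"
      by linarith
  qed (simp only: index_add_vec(2) index_minus_vec(2) carrier_vecD[OF GQ] carrier_vecD[OF b])
  finally have "c j = the (mat_inverse A) *\<^sub>v (A *\<^sub>v (G *\<^sub>v c (j - 1) + Q j))"
    by (simp only: c_eq)
  also have "\<dots> = G *\<^sub>v c (j - 1) + Q j"
    by (rule inv(2)[OF add_carrier_vec[OF Gc Q]])
  finally show "limit_state \<kappa> r q \<Xi> j
      = companion \<kappa> r *\<^sub>v limit_state \<kappa> r q \<Xi> (j - 1) + input_vec \<kappa> q (block_at \<Xi> j)"
    by (simp add: c_def Q_def G_def)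
qed

text \<open>Below the top entry the input vanishes and the companion matrix only shifts. This
  reduces the vector identity to a scalar recurrence comparable with
  \<open>decay_state\<close>.\<close>

lemma limit_state_coordinate:
  assumes \<kappa>: "0 < \<kappa>" and r: "\<And>i. i \<in> {1..\<kappa>} \<Longrightarrow> 0 \<le> r i"
    and S1: "(\<Sum>i\<in>{1..\<kappa>}. r i) < 1" and ne: "\<Xi> \<noteq> []" and i: "i < \<kappa>"
  shows "limit_state \<kappa> r q \<Xi> j $ i = limit_state \<kappa> r q \<Xi> (j - int i) $ 0"
  using i
proof (induction i arbitrary: j)
  case (Suc i)
  note step = limit_state_step[OF \<kappa> r S1 ne, where q = q]
  have "limit_state \<kappa> r q \<Xi> j $ Suc i = limit_state \<kappa> r q \<Xi> (j - 1) $ i"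
    using Suc.prems companion_mult_vec_Suc[OF step(1) Suc.prems, of r "j - 1"]
    by (subst step(2)) (simp_all add: input_vec_def)
  also have "\<dots> = limit_state \<kappa> r q \<Xi> (j - 1 - int i) $ 0"
    using Suc by simp
  finally show ?case by (simp add: algebra_simps)
qed simp

lemma limit_state_recurrence:
  assumes \<kappa>: "0 < \<kappa>" and r: "\<And>i. i \<in> {1..\<kappa>} \<Longrightarrow> 0 \<le> r i"
    and S1: "(\<Sum>i\<in>{1..\<kappa>}. r i) < 1" and ne: "\<Xi> \<noteq> []"
  shows "limit_state \<kappa> r q \<Xi> j $ 0
    = (\<Sum>i\<in>{1..\<kappa>}. r i * limit_state \<kappa> r q \<Xi> (j - int i) $ 0) + q (block_at \<Xi> j)"
proof -
  note step = limit_state_step[OF \<kappa> r S1 ne, where q = q]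
  have "limit_state \<kappa> r q \<Xi> j $ 0
      = (companion \<kappa> r *\<^sub>v limit_state \<kappa> r q \<Xi> (j - 1)) $ 0 + q (block_at \<Xi> j)"
    using \<kappa> by (subst step(2)) (simp_all add: input_vec_def)
  also have "(companion \<kappa> r *\<^sub>v limit_state \<kappa> r q \<Xi> (j - 1)) $ 0
      = (\<Sum>i\<in>{1..\<kappa>}. r i * limit_state \<kappa> r q \<Xi> (j - 1) $ (i - 1))"
    by (rule companion_mult_vec_0[OF step(1) \<kappa>])
  also have "\<dots> = (\<Sum>i\<in>{1..\<kappa>}. r i * limit_state \<kappa> r q \<Xi> (j - int i) $ 0)"
  proof (rule sum.cong)
    fix i assume "i \<in> {1..\<kappa>}"
    then show "r i * limit_state \<kappa> r q \<Xi> (j - 1) $ (i - 1)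
        = r i * limit_state \<kappa> r q \<Xi> (j - int i) $ 0"
      using limit_state_coordinate[OF \<kappa> r S1 ne, of "i - 1" q "j - 1"]
      by (cases i) (auto simp: algebra_simps)
  qed simp
  finally show ?thesis .
qed

section \<open>Periodic sequences and their means\<close>

lemma periodic_int_mult:
  fixes p :: "int \<Rightarrow> 'a"
  assumes per: "\<And>i. p (i + int l) = p i"
  shows "p (i + k * int l) = p i"
proof (induction k rule: int_induct[where k = 0])
  case (step1 k)
  then show ?case using per[of "i + k * int l"] by (simp add: algebra_simps)
next
  case (step2 k)
  then show ?case using per[of "i + (k - 1) * int l"] by (simp add: algebra_simps)
qed simp

lemma periodic_bounded:
  fixes p :: "int \<Rightarrow> real"
  assumes l: "0 < l" and per: "\<And>i. p (i + int l) = p i"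
  shows "\<exists>C. \<forall>i. \<bar>p i\<bar> \<le> C"
proof (intro exI allI)
  fix i
  have "p i = p (i mod int l)"
    using periodic_int_mult[of p l "i mod int l" "i div int l", OF per] by simp
  also have "\<bar>\<dots>\<bar> \<le> (\<Sum>k\<in>{0..<int l}. \<bar>p k\<bar>)"
    using l by (intro member_le_sum[of "i mod int l" _ "\<lambda>k. \<bar>p k\<bar>"]) auto
  finally show "\<bar>p i\<bar> \<le> (\<Sum>k\<in>{0..<int l}. \<bar>p k\<bar>)" .
qed

text \<open>Sliding the window by one drops p j and gains the equal value p (j + l). Induction in
  both directions starts at j = 1, where the window is the standard period.\<close>

lemma periodic_sum_over_period:
  fixes p :: "int \<Rightarrow> real"
  assumes per: "\<And>i. p (i + int l) = p i"
  shows "(\<Sum>s<l. p (j + int s)) = (\<Sum>i\<in>{1..int l}. p i)"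
proof -
  have step: "(\<Sum>s<l. p (j + 1 + int s)) = (\<Sum>s<l. p (j + int s))" for j
  proof -
    have "(\<Sum>s<Suc l. p (j + int s)) = p j + (\<Sum>s<l. p (j + 1 + int s))"
      by (simp add: sum.lessThan_Suc_shift algebra_simps del: sum.lessThan_Suc)
    then show ?thesis using per[of j] by simp
  qed
  have "(\<Sum>s<l. p (j + int s)) = (\<Sum>s<l. p (1 + int s))"
  proof (induction j rule: int_induct[where k = 1])
    case (step1 j)
    then show ?case using step[of j] by simp
  next
    case (step2 j)
    then show ?case using step[of "j - 1"] by simp
  qed simp
  also have "\<dots> = (\<Sum>i\<in>{1..int l}. p i)"
    by (rule sum.reindex_bij_witness[of _ "\<lambda>i. nat (i - 1)" "\<lambda>s. 1 + int s"]) auto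
  finally show ?thesis .
qed

text \<open>Complete periods contribute no discrepancy. What remains has fewer than l terms, and
  both the partial sum and its share of the mean are at most l * W there.\<close>

lemma periodic_sum_discrepancy:
  fixes p :: "int \<Rightarrow> real"
  assumes l: "0 < l" and per: "\<And>i. p (i + int l) = p i" and W: "\<And>i. \<bar>p i\<bar> \<le> W"
  shows "\<bar>(\<Sum>s<n. p (j + int s)) - real n * ((1 / real l) * (\<Sum>i\<in>{1..int l}. p i))\<bar>
    \<le> 2 * real l * W"
proof (induction n rule: less_induct)
  case (less n)
  define d where "d = (1 / real l) * (\<Sum>i\<in>{1..int l}. p i)"
  define F where "F n = (\<Sum>s<n. p (j + int s))" for n
  have P: "(\<Sum>s<l. p (j + int s)) = real l * d"
    using periodic_sum_over_period[of p l j, OF per] l by (simp add: d_def)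
  have W0: "0 \<le> W" using W[of 0] by linarith
  have Fb: "\<bar>F n\<bar> \<le> real n * W" for n
    using sum_bounded_above[of "{..<n}" "\<lambda>s. \<bar>p (j + int s)\<bar>" W] W
    by (auto simp: F_def intro: order_trans[OF sum_abs])
  have "real l * \<bar>d\<bar> \<le> real l * W"
    using Fb[of l] P by (simp add: F_def abs_mult)
  then have d: "\<bar>d\<bar> \<le> W" using l by simp
  have F_add: "F (n + l) = F n + real l * d" for n
  proof (induction n)
    case 0
    then show ?case using P by (simp add: F_def)
  next
    case (Suc n)
    have "F (Suc n + l) = F (n + l) + p (j + int n + int l)"
      by (simp add: F_def algebra_simps)
    then show ?case using Suc.IH per[of "j + int n"] by (simp add: F_def)
  qed
  have "\<bar>F n - real n * d\<bar> \<le> 2 * real l * W"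
  proof (cases "n < l")
    case True
    have "\<bar>real n * d\<bar> \<le> real n * W"
      using d by (simp add: abs_mult mult_left_mono)
    moreover have "real n * W \<le> real l * W"
      using True W0 by (intro mult_right_mono) auto
    ultimately show ?thesis using Fb[of n] by linarith
  next
    case False
    then have "F n = F (n - l) + real l * d" "real n * d = real (n - l) * d + real l * d"
      using F_add[of "n - l"] by (auto simp: of_nat_diff algebra_simps)
    moreover have "\<bar>F (n - l) - real (n - l) * d\<bar> \<le> 2 * real l * W"
      using less.IH[of "n - l"] False l by (simp add: F_def d_def)
    ultimately show ?thesis by simp
  qed
  then show ?case by (simp add: F_def d_def)
qed

text \<open>The total error is at most 2W for each of at most s0 early terms, \<epsilon>/2 for each
  term, and 2lW for the periodic discrepancy. The lower bound on M makes 2W(s0 + l) at most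
  M\<epsilon>/2.\<close>

lemma mean_perturbed_periodic:
  fixes p :: "int \<Rightarrow> real" and a :: "nat \<Rightarrow> real"
  assumes l: "0 < l" and per: "\<And>i. p (i + int l) = p i"
    and W: "\<And>i. \<bar>p i\<bar> \<le> W" "\<And>s. \<bar>a s\<bar> \<le> W"
    and close: "\<And>s. s0 \<le> s \<Longrightarrow> \<bar>a s - p (j + int s - 1)\<bar> \<le> \<epsilon> / 2"
    and M: "0 < M" "4 * W * real (s0 + l) \<le> real M * \<epsilon>" and \<epsilon>: "0 \<le> \<epsilon>"
  shows "\<bar>(1 / real M) * (\<Sum>s = 1..M. a s) - (1 / real l) * (\<Sum>i\<in>{1..int l}. p i)\<bar> \<le> \<epsilon>"
proof -
  define d where "d = (1 / real l) * (\<Sum>i\<in>{1..int l}. p i)"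
  have W0: "0 \<le> W" using W(1)[of 0] by linarith
  have "(\<Sum>s = 1..M. p (j + int s - 1)) = (\<Sum>s<M. p (j + int s))"
    by (rule sum.reindex_bij_witness[of _ Suc "\<lambda>s. s - 1"]) (auto simp: of_nat_diff algebra_simps)
  then have per_part: "\<bar>(\<Sum>s = 1..M. p (j + int s - 1)) - real M * d\<bar> \<le> 2 * real l * W"
    using periodic_sum_discrepancy[of l p W j M, OF l per W(1)] by (simp add: d_def)
  have "\<bar>(\<Sum>s = 1..M. a s) - (\<Sum>s = 1..M. p (j + int s - 1))\<bar>
      = \<bar>\<Sum>s = 1..M. a s - p (j + int s - 1)\<bar>"
    by (simp add: sum_subtractf)
  also have "\<dots> \<le> (\<Sum>s = 1..M. \<bar>a s - p (j + int s - 1)\<bar>)"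
    by (rule sum_abs)
  also have "\<dots> \<le> (\<Sum>s = 1..M. (if s < s0 then 2 * W else 0) + \<epsilon> / 2)"
  proof (rule sum_mono)
    fix s
    show "\<bar>a s - p (j + int s - 1)\<bar> \<le> (if s < s0 then 2 * W else 0) + \<epsilon> / 2"
      using close[of s] W(1)[of "j + int s - 1"] W(2)[of s] \<epsilon> by auto
  qed
  also have "\<dots> = (\<Sum>s\<in>{1..M} \<inter> {..<s0}. 2 * W) + real M * (\<epsilon> / 2)"
    by (simp add: sum.distrib sum.If_cases lessThan_def)
  also have "\<dots> \<le> real s0 * (2 * W) + real M * (\<epsilon> / 2)"
  proof -
    have "card ({1..M} \<inter> {..<s0}) \<le> s0"
      using card_mono[of "{..<s0}" "{1..M} \<inter> {..<s0}"] by simp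
    then show ?thesis using W0 by (simp add: mult_right_mono)
  qed
  finally have "\<bar>(\<Sum>s = 1..M. a s) - real M * d\<bar> \<le> real M * \<epsilon>"
    using per_part M(2) by (simp add: algebra_simps)
  moreover have "(1 / real M) * (\<Sum>s = 1..M. a s) - d = ((\<Sum>s = 1..M. a s) - real M * d) / real M"
    using M(1) by (simp add: field_simps)
  ultimately show ?thesis
    using M(1) by (simp add: d_def field_simps)
qed

section \<open>Convergence of the decay states\<close>

text \<open>Causality: the recursion up to time t reads only the first t treatments. It allows
  states computed from segments of different lengths to be compared.\<close>

lemma decay_state_cong:
  assumes "\<And>n. n < nat t \<Longrightarrow> xs ! n = ys ! n"
  shows "decay_state \<kappa> r q init xs t = decay_state \<kappa> r q init ys t"
  using assms
proof (induction "nat t" arbitrary: t rule: less_induct)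
  case less
  show ?case
  proof (cases "t \<le> 0")
    case True
    then show ?thesis by (simp add: decay_state.simps[of _ _ _ _ _ t])
  next
    case False
    have "decay_state \<kappa> r q init xs (t - int i) = decay_state \<kappa> r q init ys (t - int i)"
      if "i \<in> {1..\<kappa>}" for i
      using that False by (intro less.hyps) (auto intro: less.prems)
    moreover have "xs ! nat (t - 1) = ys ! nat (t - 1)"
      using False by (intro less.prems) auto
    ultimately show ?thesis
      using False
      by (simp add: decay_state.simps[of _ _ _ _ xs t] decay_state.simps[of _ _ _ _ ys t])
  qed
qed

text \<open>The interval [-C, C] is invariant: the past contributes at most SC and the input at most
  (1 - S)C, where S is the coefficient sum.\<close>

lemma decay_state_bound:
  assumes r: "\<And>i. i \<in> {1..\<kappa>} \<Longrightarrow> 0 \<le> r i"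
    and init: "\<And>t. t \<in> {1 - int \<kappa>..0} \<Longrightarrow> \<bar>init t\<bar> \<le> C"
    and q: "\<And>n. n < nat t \<Longrightarrow> \<bar>q (xs ! n)\<bar> \<le> (1 - (\<Sum>i\<in>{1..\<kappa>}. r i)) * C"
    and t: "1 - int \<kappa> \<le> t"
  shows "\<bar>decay_state \<kappa> r q init xs t\<bar> \<le> C"
  using t q
proof (induction "nat t" arbitrary: t rule: less_induct)
  case less
  show ?case
  proof (cases "t \<le> 0")
    case True
    then show ?thesis using init less.prems by (simp add: decay_state.simps[of _ _ _ _ _ t])
  next
    case False
    have "\<bar>\<Sum>i\<in>{1..\<kappa>}. r i * decay_state \<kappa> r q init xs (t - int i)\<bar>
        \<le> (\<Sum>i\<in>{1..\<kappa>}. r i * C)"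
    proof (rule order_trans[OF sum_abs sum_mono])
      fix i assume i: "i \<in> {1..\<kappa>}"
      have "n < nat t" if "n < nat (t - int i)" for n
        using that by linarith
      then have "\<bar>decay_state \<kappa> r q init xs (t - int i)\<bar> \<le> C"
        using i False less.prems(2) by (intro less.hyps) auto
      then show "\<bar>r i * decay_state \<kappa> r q init xs (t - int i)\<bar> \<le> r i * C"
        using r[OF i] by (simp add: abs_mult mult_left_mono)
    qed
    moreover have "\<bar>q (xs ! nat (t - 1))\<bar> \<le> (1 - (\<Sum>i\<in>{1..\<kappa>}. r i)) * C"
      using False by (intro less.prems(2)) auto
    ultimately show ?thesis
      using False
      by (simp add: decay_state.simps[of _ _ _ _ _ t] sum_distrib_right[symmetric] left_diff_distrib)
  qed
qed

text \<open>The right-hand side is independent of s, so segments of different lengths agree wherever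
  both are defined.\<close>

lemma nth_append_block_segment:
  assumes "n < length z + s"
  shows "(z @ block_segment \<Xi> j (int s + j - 1)) ! n
    = (if n < length z then z ! n else block_at \<Xi> (j + int (n - length z)))"
  using assms by (auto simp: nth_append block_segment_def)

lemma block_segment_treatments:
  assumes "\<Xi> \<noteq> []" "set \<Xi> \<subseteq> X" "set z \<subseteq> X" "n < length z + s"
  shows "(z @ block_segment \<Xi> j (int s + j - 1)) ! n \<in> X"
  using assms block_at_in_set[of \<Xi>] by (auto simp: nth_append_block_segment intro: nth_mem)

lemma decay_state_uniformly_bounded:
  assumes r: "\<And>i. i \<in> {1..\<kappa>} \<Longrightarrow> 0 \<le> r i"
    and S1: "(\<Sum>i\<in>{1..\<kappa>}. r i) < 1" and X: "finite X"
  shows "\<exists>C. \<forall>t xs. 1 - int \<kappa> \<le> t \<longrightarrow> (\<forall>n<nat t. xs ! n \<in> X) \<longrightarrow>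
    \<bar>decay_state \<kappa> r q init xs t\<bar> \<le> C"
proof -
  define S where "S = (\<Sum>i\<in>{1..\<kappa>}. r i)"
  have S: "0 \<le> S" "S < 1"
    using r S1 by (auto simp: S_def intro: sum_nonneg)
  define I where "I = (\<Sum>t\<in>{1 - int \<kappa>..0}. \<bar>init t\<bar>)"
  define Q where "Q = (\<Sum>x\<in>X. \<bar>q x\<bar>)"
  have IQ: "0 \<le> I" "0 \<le> Q" by (auto simp: I_def Q_def sum_nonneg)
  \<comment> \<open>Chosen so that (1 - S)C = I + Q dominates every input; since 0 < 1 - S \<le> 1,
    C also dominates the initial values.\<close>
  define C where "C = (I + Q) / (1 - S)"
  have SC: "(1 - S) * C = I + Q" using S by (simp add: C_def)
  have "0 \<le> C" using S IQ by (simp add: C_def)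
  then have IC: "I \<le> C" using SC S IQ by (smt (verit) mult_left_le_one_le)
  have "\<bar>decay_state \<kappa> r q init xs t\<bar> \<le> C"
    if t: "1 - int \<kappa> \<le> t" and xs: "\<forall>n<nat t. xs ! n \<in> X" for t xs
  proof (rule decay_state_bound[OF r _ _ t])
    fix t assume "t \<in> {1 - int \<kappa>..0}"
    then have "\<bar>init t\<bar> \<le> I"
      unfolding I_def by (intro member_le_sum[of t _ "\<lambda>t. \<bar>init t\<bar>"]) auto
    then show "\<bar>init t\<bar> \<le> C" using IC by linarith
  next
    fix n assume "n < nat t"
    then have "\<bar>q (xs ! n)\<bar> \<le> Q"
      unfolding Q_def using xs X by (intro member_le_sum[of "xs ! n" _ "\<lambda>x. \<bar>q x\<bar>"]) auto
    then show "\<bar>q (xs ! n)\<bar> \<le> (1 - (\<Sum>i\<in>{1..\<kappa>}. r i)) * C"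
      using SC IQ by (simp add: S_def)
  qed
  then show ?thesis by blast
qed

text \<open>State and periodic limit receive the same input, so their difference solves the
  homogeneous recurrence. Its starting values are bounded independently of z and j, which makes s0
  uniform.\<close>

lemma decay_state_uniform_limit:
  assumes \<kappa>: "0 < \<kappa>" and r: "\<And>i. i \<in> {1..\<kappa>} \<Longrightarrow> 0 \<le> r i"
    and S1: "(\<Sum>i\<in>{1..\<kappa>}. r i) < 1" and X: "finite X"
    and \<Xi>: "\<Xi> \<noteq> []" "set \<Xi> \<subseteq> X" and \<delta>: "0 < \<delta>"
  shows "\<exists>s0. \<forall>s\<ge>s0. \<forall>z j. set z \<subseteq> X \<longrightarrow>
    \<bar>decay_state \<kappa> r q init (z @ block_segment \<Xi> j (int s + j - 1)) (int (length z + s))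
      - limit_state \<kappa> r q \<Xi> (j + int s - 1) $ 0\<bar> < \<delta>"
proof -
  define S where "S = (\<Sum>i\<in>{1..\<kappa>}. r i)"
  have S: "0 \<le> S" "S < 1"
    using r S1 by (auto simp: S_def intro: sum_nonneg)
  define c where "c j = limit_state \<kappa> r q \<Xi> j $ 0" for j
  obtain C1 where C1: "\<And>t xs. 1 - int \<kappa> \<le> t \<Longrightarrow> (\<And>n. n < nat t \<Longrightarrow> xs ! n \<in> X) \<Longrightarrow>
    \<bar>decay_state \<kappa> r q init xs t\<bar> \<le> C1"
    using decay_state_uniformly_bounded[of \<kappa> r X q init, OF r S1 X] by blast
  obtain C2 where C2: "\<And>j. \<bar>c j\<bar> \<le> C2"
    using periodic_bounded[of "length \<Xi>" c] \<Xi> by (auto simp: c_def limit_state_add_length)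
  have bound: "\<bar>decay_state \<kappa> r q init (z @ block_segment \<Xi> j (int s + j - 1)) (int (length z + s))
      - c (j + int s - 1)\<bar> \<le> (C1 + C2) * S ^ ((s + \<kappa> - 1) div \<kappa>)"
    if z: "set z \<subseteq> X" for s z j
  proof -
    define Y where "Y m = decay_state \<kappa> r q init (z @ block_segment \<Xi> j (int m + j - 1))" for m
    \<comment> \<open>Index n stands for s = n + 1 - \<kappa>. For n < \<kappa> the natural
      subtraction gives 0, the segment is empty, and \<open>u\<close> compares the last \<kappa>
      states up to the end of z, which may include initial values.\<close>
    define u where "u n = Y (Suc n - \<kappa>) (int (length z) + int n + 1 - int \<kappa>) - c (j + int n - int \<kappa>)"
      for n
    have treat: "(z @ block_segment \<Xi> j (int m + j - 1)) ! k \<in> X" if "k < length z + m" for k m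
      using block_segment_treatments[OF \<Xi> z that] .
    have "\<bar>u (s + \<kappa> - 1)\<bar> \<le> (C1 + C2) * S ^ ((s + \<kappa> - 1) div \<kappa>)"
      unfolding S_def
    proof (rule stable_recurrence_decay[OF \<kappa> r])
      fix n assume n: "n < \<kappa>"
      have "\<bar>Y (Suc n - \<kappa>) (int (length z) + int n + 1 - int \<kappa>)\<bar> \<le> C1"
        unfolding Y_def using n by (intro C1 treat) auto
      then show "\<bar>u n\<bar> \<le> C1 + C2"
        using C2[of "j + int n - int \<kappa>"] by (simp add: u_def)
    next
      fix n assume n: "\<kappa> \<le> n"
      define t where "t = int (length z) + int n + 1 - int \<kappa>"
      have t: "0 < t" using n by (simp add: t_def)
      have "Y (Suc n - \<kappa>) t = (\<Sum>i\<in>{1..\<kappa>}. r i * Y (Suc n - \<kappa>) (t - int i))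
          + q ((z @ block_segment \<Xi> j (int (Suc n - \<kappa>) + j - 1)) ! nat (t - 1))"
        unfolding Y_def using t by (subst decay_state.simps) simp
      also have "(z @ block_segment \<Xi> j (int (Suc n - \<kappa>) + j - 1)) ! nat (t - 1)
          = block_at \<Xi> (j + int n - int \<kappa>)"
      proof -
        have "nat (t - 1) = length z + (n - \<kappa>)" using n by (simp add: t_def)
        then show ?thesis
          using n by (subst nth_append_block_segment) (auto simp: of_nat_diff algebra_simps)
      qed
      \<comment> \<open>By causality each earlier state may be computed from the list truncated to
        its own time, the form in which it occurs in \<open>u\<close>.\<close>
      also have "(\<Sum>i\<in>{1..\<kappa>}. r i * Y (Suc n - \<kappa>) (t - int i))
          = (\<Sum>i\<in>{1..\<kappa>}. r i * Y (Suc (n - i) - \<kappa>) (t - int i))"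
      proof (rule sum.cong)
        fix i assume i: "i \<in> {1..\<kappa>}"
        have "Y (Suc n - \<kappa>) (t - int i) = Y (Suc (n - i) - \<kappa>) (t - int i)"
          unfolding Y_def
        proof (rule decay_state_cong)
          fix k assume k: "k < nat (t - int i)"
          then have "k < length z + (Suc n - \<kappa>)" "k < length z + (Suc (n - i) - \<kappa>)"
            using i n by (auto simp: t_def)
          then show "(z @ block_segment \<Xi> j (int (Suc n - \<kappa>) + j - 1)) ! k
              = (z @ block_segment \<Xi> j (int (Suc (n - i) - \<kappa>) + j - 1)) ! k"
            by (simp only: nth_append_block_segment)
        qed
        then show "r i * Y (Suc n - \<kappa>) (t - int i) = r i * Y (Suc (n - i) - \<kappa>) (t - int i)"
          by simp
      qed simp
      finally have Y: "Y (Suc n - \<kappa>) t = (\<Sum>i\<in>{1..\<kappa>}. r i * Y (Suc (n - i) - \<kappa>) (t - int i))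
          + q (block_at \<Xi> (j + int n - int \<kappa>))" .
      have c: "c (j + int n - int \<kappa>) = (\<Sum>i\<in>{1..\<kappa>}. r i * c (j + int n - int \<kappa> - int i))
          + q (block_at \<Xi> (j + int n - int \<kappa>))"
        unfolding c_def by (rule limit_state_recurrence[OF \<kappa> r S1 \<Xi>(1)])
      have "u n = (\<Sum>i\<in>{1..\<kappa>}. r i * Y (Suc (n - i) - \<kappa>) (t - int i)
          - r i * c (j + int n - int \<kappa> - int i))"
        using Y c by (simp add: u_def t_def sum_subtractf)
      also have "\<dots> = (\<Sum>i\<in>{1..\<kappa>}. r i * u (n - i))"
      proof (rule sum.cong)
        fix i assume "i \<in> {1..\<kappa>}"
        then have "int (n - i) = int n - int i" using n by auto
        then show "r i * Y (Suc (n - i) - \<kappa>) (t - int i) - r i * c (j + int n - int \<kappa> - int i)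
            = r i * u (n - i)"
          by (simp add: u_def t_def algebra_simps)
      qed simp
      finally show "u n = (\<Sum>i\<in>{1..\<kappa>}. r i * u (n - i))" .
    qed (use S1 in auto)
    moreover have "u (s + \<kappa> - 1)
        = decay_state \<kappa> r q init (z @ block_segment \<Xi> j (int s + j - 1)) (int (length z + s))
          - c (j + int s - 1)"
    proof -
      have "Suc (s + \<kappa> - 1) - \<kappa> = s" "int (s + \<kappa> - 1) = int s + int \<kappa> - 1"
        using \<kappa> by auto
      then show ?thesis by (simp add: u_def Y_def algebra_simps)
    qed
    ultimately show ?thesis by simp
  qed
  have "(\<lambda>m. (C1 + C2) * S ^ m) \<longlonglongrightarrow> (C1 + C2) * 0"
    using S by (intro tendsto_intros LIMSEQ_realpow_zero)
  then have "eventually (\<lambda>m. (C1 + C2) * S ^ m < \<delta>) sequentially"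
    using \<delta> by (intro order_tendstoD(2)) auto
  then obtain m where m: "\<And>k. m \<le> k \<Longrightarrow> (C1 + C2) * S ^ k < \<delta>"
    by (auto simp: eventually_sequentially)
  have "m \<le> (s + \<kappa> - 1) div \<kappa>" if "m * \<kappa> \<le> s" for s
    using that \<kappa> by (simp add: less_eq_div_iff_mult_less_eq)
  then have "\<forall>s\<ge>m * \<kappa>. \<forall>z j. set z \<subseteq> X \<longrightarrow>
    \<bar>decay_state \<kappa> r q init (z @ block_segment \<Xi> j (int s + j - 1)) (int (length z + s))
      - limit_state \<kappa> r q \<Xi> (j + int s - 1) $ 0\<bar> < \<delta>"
    using bound m by (fold c_def) (meson le_less_trans)
  then show ?thesis by blast
qed

section \<open>Convergence of the means\<close>

theorem lemmaF1:
  fixes K \<kappa> l :: nat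
    and \<Psi> :: "real \<Rightarrow> real"
    and r q :: "nat \<Rightarrow> real"
    and init :: "int \<Rightarrow> real"
    and \<Xi> :: "nat list"
    and \<epsilon> :: real
  assumes "K \<ge> 2"
    and "\<kappa> \<ge> 1"
    and "\<And>x. 0 \<le> \<Psi> x \<and> \<Psi> x < 1"
    and "\<And>i. i \<in> {1..\<kappa>} \<Longrightarrow> 0 \<le> r i \<and> r i \<le> 1"
    and "\<And>x. x \<in> {1..K} \<Longrightarrow> 0 \<le> q x"
    and "continuous_on UNIV \<Psi>"
    and "spectral_radius (map_mat complex_of_real (companion \<kappa> r)) < 1"
    and "l \<ge> 1" "length \<Xi> = l" "set \<Xi> \<subseteq> {1..K}"
    and "\<epsilon> > 0"
  shows "\<exists>M0::nat. M0 > 0 \<and> (\<forall>M\<ge>M0.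
    (SUP (t, z, j) \<in> {(t::nat, z, j). length z = t \<and> set z \<subseteq> {1..K} \<and> j \<in> {1..int l}}.
      ereal \<bar>(1 / real M) *
          (\<Sum>s = 1..M. omega (change_prob \<Psi> \<kappa> r q init (t + s)
                               (z @ block_segment \<Xi> j (int s + j - 1))))
        - block_mean \<Psi> \<kappa> r q \<Xi>\<bar>) \<le> ereal \<epsilon>)"
proof -
  have \<kappa>: "0 < \<kappa>" and r: "\<And>i. i \<in> {1..\<kappa>} \<Longrightarrow> 0 \<le> r i" and ne: "\<Xi> \<noteq> []" and l: "0 < l"
    using assms by auto
  have S1: "(\<Sum>i\<in>{1..\<kappa>}. r i) < 1"
    using \<kappa> r assms(7) by (rule coefficient_sum_less_1)
  define g where "g x = omega (\<Psi> x)" for x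
  define c where "c j = limit_state \<kappa> r q \<Xi> j $ 0" for j
  define \<xi> where "\<xi> z j s = decay_state \<kappa> r q init (z @ block_segment \<Xi> j (int s + j - 1))
    (int (length z + s))" for z j s
  have c_per: "c (j + int l) = c j" for j
    using assms(9) limit_state_add_length[of \<kappa> r q \<Xi> j] by (simp add: c_def)
  obtain C1 where C1: "\<And>t xs. 1 - int \<kappa> \<le> t \<Longrightarrow> (\<And>n. n < nat t \<Longrightarrow> xs ! n \<in> {1..K}) \<Longrightarrow>
    \<bar>decay_state \<kappa> r q init xs t\<bar> \<le> C1"
    using decay_state_uniformly_bounded[of \<kappa> r "{1..K}" q init, OF r S1] by blast
  obtain C2 where C2: "\<And>j. \<bar>c j\<bar> \<le> C2"
    using periodic_bounded[of l c, OF l c_per] by blast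
  \<comment> \<open>One compact interval holding all states and all limit values, as uniform
    continuity requires.\<close>
  define C where "C = max C1 C2"
  have \<xi>_C: "\<xi> z j s \<in> {-C..C}" if "set z \<subseteq> {1..K}" for z j s
  proof -
    have "\<bar>\<xi> z j s\<bar> \<le> C1"
      unfolding \<xi>_def using \<kappa> block_segment_treatments[OF ne assms(10) that]
      by (intro C1) auto
    then show ?thesis by (auto simp: C_def)
  qed
  have c_C: "c j \<in> {-C..C}" for j
    using C2[of j] by (auto simp: C_def)
  have g_cont: "continuous_on {-C..C} g"
  proof -
    have "continuous_on {-C..C} \<Psi>"
      using assms(6) by (rule continuous_on_subset) simp
    \<comment> \<open>Since \<Psi> stays strictly below 1, the logarithm is never evaluated at its
      singularity.\<close>
    moreover have "1 - \<Psi> x \<noteq> 0" for x using assms(3)[of x] by simp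
    ultimately show ?thesis
      unfolding g_def omega_def by (intro continuous_intros) auto
  qed
  have "bounded (g ` {-C..C})"
    using g_cont by (intro compact_imp_bounded compact_continuous_image) auto
  then obtain W where W: "\<And>x. x \<in> {-C..C} \<Longrightarrow> \<bar>g x\<bar> \<le> W"
    unfolding bounded_iff real_norm_def by blast
  have "uniformly_continuous_on {-C..C} g"
    using g_cont by (intro compact_uniformly_continuous) auto
  then obtain \<delta> where \<delta>: "0 < \<delta>"
    "\<And>x y. x \<in> {-C..C} \<Longrightarrow> y \<in> {-C..C} \<Longrightarrow> \<bar>x - y\<bar> < \<delta> \<Longrightarrow> \<bar>g x - g y\<bar> < \<epsilon> / 2"
    unfolding uniformly_continuous_on_def dist_real_def using assms(11)
    by (metis half_gt_zero abs_minus_commute)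
  obtain s0 where s0: "\<And>s z j. s0 \<le> s \<Longrightarrow> set z \<subseteq> {1..K} \<Longrightarrow> \<bar>\<xi> z j s - c (j + int s - 1)\<bar> < \<delta>"
    using decay_state_uniform_limit[of \<kappa> r "{1..K}" \<Xi> \<delta> q init, OF \<kappa> r S1 _ ne assms(10) \<delta>(1)]
    unfolding \<xi>_def c_def by blast
  \<comment> \<open>The quotient is the threshold of \<open>mean_perturbed_periodic\<close>;
    \<open>Suc\<close> keeps \<open>M0\<close> positive.\<close>
  define M0 where "M0 = Suc (nat \<lceil>4 * W * real (s0 + l) / \<epsilon>\<rceil>)"
  have mean: "\<bar>(1 / real M) * (\<Sum>s = 1..M. g (\<xi> z j s)) - block_mean \<Psi> \<kappa> r q \<Xi>\<bar> \<le> \<epsilon>"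
    if M: "M0 \<le> M" and z: "set z \<subseteq> {1..K}" for M z j
  proof -
    have "4 * W * real (s0 + l) / \<epsilon> \<le> real M"
      using M unfolding M0_def by linarith
    then have "4 * W * real (s0 + l) \<le> real M * \<epsilon>"
      using assms(11) by (simp add: pos_divide_le_eq)
    moreover have "0 < M" using M by (simp add: M0_def)
    moreover have "\<bar>g (\<xi> z j s) - g (c (j + int s - 1))\<bar> \<le> \<epsilon> / 2" if "s0 \<le> s" for s
      using \<delta>(2)[OF \<xi>_C[OF z] c_C s0[OF that z]] by (rule less_imp_le)
    ultimately have "\<bar>(1 / real M) * (\<Sum>s = 1..M. g (\<xi> z j s))
        - (1 / real l) * (\<Sum>i\<in>{1..int l}. g (c i))\<bar> \<le> \<epsilon>"
      using W \<xi>_C[OF z] c_C c_per l assms(11)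
      by (intro mean_perturbed_periodic[where W = W and ?s0.0 = s0 and j = j]) auto
    then show ?thesis
      using assms(9) by (simp add: block_mean_def g_def c_def)
  qed
  \<comment> \<open>The supremum is taken in the extended reals, so the pointwise bound
    suffices.\<close>
  have "\<forall>M\<ge>M0.
    (SUP (t, z, j) \<in> {(t::nat, z, j). length z = t \<and> set z \<subseteq> {1..K} \<and> j \<in> {1..int l}}.
      ereal \<bar>(1 / real M) *
          (\<Sum>s = 1..M. omega (change_prob \<Psi> \<kappa> r q init (t + s)
                               (z @ block_segment \<Xi> j (int s + j - 1))))
        - block_mean \<Psi> \<kappa> r q \<Xi>\<bar>) \<le> ereal \<epsilon>"
    using mean by (auto intro!: SUP_least simp: change_prob_def g_def \<xi>_def)
  moreover have "0 < M0" by (simp add: M0_def)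
  ultimately show ?thesis by blast
qed

end
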